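(* Let $m\ge 1$ and let $A_1,\dots,A_m$ be a reduced set of patterns over a finite alphabet $\Omega$. For each $1\le i\le m$, the probability $Pr(\tau=\tau_i)$ that the pattern $A_i$ precedes all the remaining $m-1$ patterns is equal to $g_\tau^{A_i}(1)$, that is $$ Pr(\tau=\tau_i)=\frac{\det \mathcal{B}^i(1)}{\sum_{j=1}^m \det \mathcal{B}^j(1)}, $$ where the right-hand side is understood as the limit as $s\to1^-$ of $$ \frac{\det \mathcal{B}^i(s)}{\sum_{j=1}^{m}\det \mathcal{B}^j(s)+(1-s)\det \mathcal{B}(s)}. $$
   Context: Let $(\xi_n)_{n\ge1}$ be a sequence of i.i.d. random letters from a finite alphabet $\Omega$. For a pattern (word) $A=(a_1,\dots,a_l)\in\Omega^l$, $l\ge 1$, put $Pr(A)=\prod_{k=1}^l Pr(\xi_1=a_k)$; $A_{(k)}=(a_1,\dots,a_k)$ and $A^{(k)}=(a_{l-k+1},\dots,a_l)$ denote the words formed by its first and last $k$ letters, and $Pr(A^{(0)})=1$. For words $U,V$, $[U=V]$ is $1$ if $U=V$ and $0$ otherwise. For patterns $A$, $B$ of lengths $l$, $m'$, the correlation polynomial is $$w_A^B(s)=\sum_{k=1}^{\min\{l,m'\}}[A_{(k)}=B^{(k)}]\,Pr(A^{(l-k)})\,s^{l-k}.$$ A set of $m$ patterns $A_1,\dots,A_m$ of lengths $l_1,\dots,l_m$ is reduced if none of the patterns contains any other as a subpattern (i.e. as a block of consecutive letters). Let $\tau_i$ be the stopping time until $A_i$ occurs, i.e. the least $n\ge l_i$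 with $(\xi_{n-l_i+1},\dots,\xi_n)=A_i$, and $\tau=\min\{\tau_i:1\le i\le m\}$. Put $p_n^{A_i}=Pr(\tau=\tau_i=n)$ and $g_\tau^{A_i}(s)=\sum_{n=0}^\infty p_n^{A_i}s^n$. The event $\{\tau=\tau_i\}$ means that $A_i$ occurs, at a finite time, before all the other patterns, so $Pr(\tau=\tau_i)=\sum_{n}Pr(\tau=\tau_i=n)$. Let $\mathcal{B}(s)=[w_{A_i}^{A_j}(s)]_{1\le i,j\le m}$ (row index $i$, column index $j$), and let $\mathcal{B}^j(s)$ be the matrix obtained by replacing the $j$-th column of $\mathcal{B}(s)$ by the column vector $[Pr(A_i)s^{l_i}]_{1\le i\le m}$. *)

theory Defs
  imports "HOL-Probability.Probability" "HOL-Library.Sublist" "HOL-Library.Extended_Nat"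
begin

definition word_prob :: "('a \<Rightarrow> real) \<Rightarrow> 'a list \<Rightarrow> real" where
  "word_prob p U = (\<Prod>k<length U. p (U ! k))"

definition first_letters :: "nat \<Rightarrow> 'a list \<Rightarrow> 'a list" where
  "first_letters k U = take k U"

definition last_letters :: "nat \<Rightarrow> 'a list \<Rightarrow> 'a list" where
  "last_letters k U = drop (length U - k) U"

text \<open>The correlation polynomial \<open>w\<^sub>A\<^sup>B(s)\<close>; it is not symmetric in \<open>A\<close> and \<open>B\<close>.\<close>

definition correlation :: "('a \<Rightarrow> real) \<Rightarrow> 'a list \<Rightarrow> 'a list \<Rightarrow> real \<Rightarrow> real" where
  "correlation p A B s =
     (\<Sum>k = 1..min (length A) (length B).
        of_bool (first_letters k A = last_letters k B) *
        word_prob p (last_letters (length A - k) A) * s ^ (length A - k))"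

text \<open>\<open>sublist\<close> is containment as a block of consecutive letters. Since distinct indices are
  compared, a reduced family is in particular injective.\<close>

definition reduced_patterns :: "('m \<Rightarrow> 'a list) \<Rightarrow> bool" where
  "reduced_patterns A \<longleftrightarrow> (\<forall>i j. i \<noteq> j \<longrightarrow> \<not> sublist (A i) (A j))"

text \<open>Letters are numbered from 1; \<open>x 0\<close> is never read when \<open>U\<close> is nonempty.\<close>

definition occurs_at :: "(nat \<Rightarrow> 'a) \<Rightarrow> 'a list \<Rightarrow> nat \<Rightarrow> bool" where
  "occurs_at x U n \<longleftrightarrow> length U \<le> n \<and> map x [n - length U + 1..<n + 1] = U"

text \<open>The value is \<open>\<infinity>\<close> (the infimum of the empty set) if \<open>U\<close> never occurs.\<close>

definition hit_time :: "(nat \<Rightarrow> 'a) \<Rightarrow> 'a list \<Rightarrow> enat" where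
  "hit_time x U = Inf {enat n | n. occurs_at x U n}"

definition min_hit_time :: "(nat \<Rightarrow> 'a) \<Rightarrow> ('m::finite \<Rightarrow> 'a list) \<Rightarrow> enat" where
  "min_hit_time x A = Min (range (\<lambda>j. hit_time x (A j)))"

definition letter_prob :: "'w measure \<Rightarrow> (nat \<Rightarrow> 'w \<Rightarrow> 'a) \<Rightarrow> 'a \<Rightarrow> real" where
  "letter_prob M \<xi> a = \<P>(\<omega> in M. \<xi> 1 \<omega> = a)"

definition first_at_prob ::
  "'w measure \<Rightarrow> (nat \<Rightarrow> 'w \<Rightarrow> 'a) \<Rightarrow> ('m::finite \<Rightarrow> 'a list) \<Rightarrow> 'm \<Rightarrow> nat \<Rightarrow> real" where
  "first_at_prob M \<xi> A i n =
     \<P>(\<omega> in M. min_hit_time (\<lambda>k. \<xi> k \<omega>) A = hit_time (\<lambda>k. \<xi> k \<omega>) (A i) \<and>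
               hit_time (\<lambda>k. \<xi> k \<omega>) (A i) = enat n)"

definition first_gf ::
  "'w measure \<Rightarrow> (nat \<Rightarrow> 'w \<Rightarrow> 'a) \<Rightarrow> ('m::finite \<Rightarrow> 'a list) \<Rightarrow> 'm \<Rightarrow> real \<Rightarrow> real" where
  "first_gf M \<xi> A i s = (\<Sum>n. first_at_prob M \<xi> A i n * s ^ n)"

text \<open>The event that \<open>A i\<close> occurs first requires it to occur at a finite time, so outcomes
  on which no pattern ever occurs (all times \<open>\<infinity>\<close>) are excluded.\<close>

definition first_prob ::
  "'w measure \<Rightarrow> (nat \<Rightarrow> 'w \<Rightarrow> 'a) \<Rightarrow> ('m::finite \<Rightarrow> 'a list) \<Rightarrow> 'm \<Rightarrow> real" where
  "first_prob M \<xi> A i =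
     \<P>(\<omega> in M. min_hit_time (\<lambda>k. \<xi> k \<omega>) A = hit_time (\<lambda>k. \<xi> k \<omega>) (A i) \<and>
               hit_time (\<lambda>k. \<xi> k \<omega>) (A i) \<noteq> \<infinity>)"

definition corr_matrix :: "('a \<Rightarrow> real) \<Rightarrow> ('m::finite \<Rightarrow> 'a list) \<Rightarrow> real \<Rightarrow> real ^ 'm ^ 'm" where
  "corr_matrix p A s = (\<chi> i j. correlation p (A i) (A j) s)"

definition corr_matrix_repl ::
  "('a \<Rightarrow> real) \<Rightarrow> ('m::finite \<Rightarrow> 'a list) \<Rightarrow> 'm \<Rightarrow> real \<Rightarrow> real ^ 'm ^ 'm" where
  "corr_matrix_repl p A j s =
     (\<chi> i k. if k = j then word_prob p (A i) * s ^ length (A i) else corr_matrix p A s $ i $ k)"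

definition precede_denom :: "('a \<Rightarrow> real) \<Rightarrow> ('m::finite \<Rightarrow> 'a list) \<Rightarrow> real \<Rightarrow> real" where
  "precede_denom p A s =
     (\<Sum>j\<in>UNIV. det (corr_matrix_repl p A j s)) + (1 - s) * det (corr_matrix p A s)"

end

theory Submission
  imports Defs
begin

text \<open>
  Let \<open>q\<^sub>n\<close> be the probability that no pattern occurs among the first \<open>n\<close> letters, let \<open>p\<^sub>n\<^sup>j\<close> be
  the probability that \<open>A j\<close> is the first pattern to occur and that it is completed by the
  \<open>n\<close>-th letter, and let \<open>Q\<close> and \<open>g\<^sub>j\<close> be the generating functions of these two sequences.

  Consider the event that no pattern has occurred by time \<open>n\<close> and that the next letters then spell
  \<open>A i\<close>. By independence it has probability \<open>q\<^sub>n Pr(A i)\<close>. On this event some pattern is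
  completed for the first time while \<open>A i\<close> is being spelt, say \<open>A j\<close> with the \<open>r\<close>-th letter of
  \<open>A i\<close>. As \<open>A j\<close> cannot be a proper block of \<open>A i\<close>, the first \<open>r\<close> letters of \<open>A i\<close> are the last \<open>r\<close>
  letters of \<open>A j\<close>. Summing over \<open>j\<close> and \<open>r\<close> (\<open>avoid_weight_times_pattern\<close>) and passing to
  generating functions gives the linear system \<open>B(s) g(s) = Q(s) v(s)\<close> with
  \<open>v\<^sub>i(s) = Pr(A i) s ^ length (A i)\<close> (\<open>correlation_system\<close>). Counting the words of length
  \<open>n + 1\<close> whose first \<open>n\<close> letters avoid all patterns gives
  \<open>(1 - s) Q(s) + (\<Sum>j. g\<^sub>j(s)) = 1\<close> (\<open>gf_total\<close>).

  Cramer's rule turns the system into \<open>det B\<^sup>j = (g\<^sub>j / Q) det B\<close>. Summing over \<open>j\<close> and inserting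
  the second identity shows that the denominator of the claim times \<open>Q\<close> is \<open>det B\<close>. So wherever
  \<open>det B(s)\<close> is nonzero, the denominator is nonzero as well and the quotient of the claim is exactly
  \<open>g\<^sub>i(s)\<close>. Since no pattern contains another, \<open>B(0)\<close> is the identity matrix; hence \<open>det B\<close> is a
  nonzero polynomial and has no zero in some interval to the left of \<open>1\<close>. The coefficients of
  \<open>g\<^sub>i\<close> are nonnegative with a finite sum, so \<open>g\<^sub>i(s)\<close> tends to \<open>g\<^sub>i(1)\<close>, which is the probability
  that \<open>A i\<close> occurs first.

  The identities between \<open>q\<^sub>n\<close> and \<open>p\<^sub>n\<^sup>j\<close> are statements about weighted sets of finite words, and
  are proved as such; the probability space enters through \<open>first_word_event\<close>, by which the
  probability of any property of the first \<open>n\<close> letters is the total weight of the words that have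
  it.
\<close>

section \<open>Weights of words that avoid all patterns or end in a first occurrence\<close>

lemma word_prob_Nil [simp]: "word_prob p [] = 1"
  by (simp add: word_prob_def)

lemma word_prob_conv_prod_list: "word_prob p U = prod_list (map p U)"
  by (simp add: word_prob_def prod.list_conv_set_nth atLeast0LessThan)

lemma word_prob_append: "word_prob p (U @ V) = word_prob p U * word_prob p V"
  by (simp add: word_prob_conv_prod_list)

locale reduced_pattern_family =
  fixes \<Omega> :: "'a set" and p :: "'a \<Rightarrow> real" and A :: "'m::finite \<Rightarrow> 'a list"
  assumes finite_alphabet: "finite \<Omega>"
    and weight_nonneg: "\<And>a. 0 \<le> p a"
    and weight_total: "(\<Sum>a\<in>\<Omega>. p a) = 1"
    and pattern_letters: "\<And>j. A j \<in> lists \<Omega>"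
    and pattern_nonempty: "\<And>j. A j \<noteq> []"
    and reduced: "reduced_patterns A"
begin

definition avoiding_words :: "nat \<Rightarrow> 'a list set" where
  "avoiding_words n = {w \<in> lists \<Omega>. length w = n \<and> (\<forall>k. \<not> sublist (A k) w)}"

definition first_words :: "'m \<Rightarrow> nat \<Rightarrow> 'a list set" where
  "first_words j n =
     {w \<in> lists \<Omega>. length w = n \<and> suffix (A j) w \<and> (\<forall>k. \<not> sublist (A k) (butlast w))}"

text \<open>In the probabilistic reading, \<open>avoid_weight n\<close> is \<open>Pr(\<tau> > n)\<close> and \<open>first_weight j n\<close> is
  \<open>Pr(\<tau> = \<tau>\<^sub>j = n)\<close>.\<close>

definition avoid_weight :: "nat \<Rightarrow> real" where
  "avoid_weight n = (\<Sum>w\<in>avoiding_words n. word_prob p w)"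

definition first_weight :: "'m \<Rightarrow> nat \<Rightarrow> real" where
  "first_weight j n = (\<Sum>w\<in>first_words j n. word_prob p w)"

lemma finite_words: "finite {w \<in> lists \<Omega>. length w = n}"
proof -
  have "{w \<in> lists \<Omega>. length w = n} = {w. set w \<subseteq> \<Omega> \<and> length w = n}"
    by auto
  then show ?thesis
    using finite_lists_length_eq[OF finite_alphabet, of n] by simp
qed

lemma finite_avoiding_words: "finite (avoiding_words n)"
  by (rule finite_subset[OF _ finite_words[of n]]) (auto simp: avoiding_words_def)

lemma finite_first_words: "finite (first_words j n)"
  by (rule finite_subset[OF _ finite_words[of n]]) (auto simp: first_words_def)

lemma word_prob_nonneg: "0 \<le> word_prob p w"
  by (simp add: word_prob_def prod_nonneg weight_nonneg)

lemma avoid_weight_nonneg: "0 \<le> avoid_weight n"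
  by (simp add: avoid_weight_def sum_nonneg word_prob_nonneg)

lemma first_weight_nonneg: "0 \<le> first_weight j n"
  by (simp add: first_weight_def sum_nonneg word_prob_nonneg)

lemma avoid_weight_0: "avoid_weight 0 = 1"
proof -
  have "avoiding_words 0 = {[]}"
    by (auto simp: avoiding_words_def pattern_nonempty)
  then show ?thesis by (simp add: avoid_weight_def)
qed

lemma first_weight_short: "n < length (A j) \<Longrightarrow> first_weight j n = 0"
proof -
  assume "n < length (A j)"
  then have "first_words j n = {}"
    by (auto simp: first_words_def dest: suffix_length_le)
  then show ?thesis by (simp add: first_weight_def)
qed

lemma sublist_patterns_eq: "sublist (A j) (A k) \<Longrightarrow> j = k"
  using reduced by (auto simp: reduced_patterns_def)

text \<open>This is why at most one pattern can be completed at a given time: of two suffixes of the same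
  word, one is a suffix of the other.\<close>

lemma suffix_patterns_eq:
  assumes "suffix (A j) w" "suffix (A k) w"
  shows "j = k"
  using suffix_same_cases[OF assms] sublist_patterns_eq by (metis suffix_imp_sublist)

lemma first_words_disjoint: "j \<noteq> k \<Longrightarrow> first_words j n \<inter> first_words k n = {}"
  using suffix_patterns_eq by (fastforce simp: first_words_def)

lemma extensions_of_avoiding_words:
  "(\<lambda>(w, a). w @ [a]) ` (avoiding_words n \<times> \<Omega>)
     = avoiding_words (Suc n) \<union> (\<Union>j. first_words j (Suc n))" (is "?L = ?R")
proof (intro equalityI subsetI)
  fix u assume "u \<in> ?L"
  then show "u \<in> ?R"
    by (auto simp: avoiding_words_def first_words_def sublist_snoc)
next
  fix u assume u: "u \<in> ?R"
  then have l: "u \<in> lists \<Omega>" "length u = Suc n" "\<forall>k. \<not> sublist (A k) (butlast u)"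
    by (auto simp: avoiding_words_def first_words_def dest: sublist_order.order_trans[OF _ sublist_butlast])
  then have "u = butlast u @ [last u]" "last u \<in> \<Omega>" "butlast u \<in> avoiding_words n"
    by (auto simp: avoiding_words_def dest: in_set_butlastD simp flip: length_greater_0_conv)
  then show "u \<in> ?L"
    by (metis (no_types, lifting) SigmaI image_eqI case_prod_conv)
qed

text \<open>Appending an arbitrary letter does not change the total weight, and the resulting words split
  according to which pattern, if any, the new letter completes.\<close>

lemma avoid_weight_Suc:
  "avoid_weight n = avoid_weight (Suc n) + (\<Sum>j\<in>UNIV. first_weight j (Suc n))"
proof -
  have inj: "inj_on (\<lambda>(w, a). w @ [a]) (avoiding_words n \<times> \<Omega>)"
    by (auto simp: inj_on_def)
  have "avoid_weight n = (\<Sum>w\<in>avoiding_words n. \<Sum>a\<in>\<Omega>. word_prob p w * p a)"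
    by (simp add: avoid_weight_def weight_total flip: sum_distrib_left)
  also have "\<dots> = (\<Sum>(w, a)\<in>avoiding_words n \<times> \<Omega>. word_prob p (w @ [a]))"
    by (simp add: sum.cartesian_product word_prob_conv_prod_list)
  also have "\<dots> = (\<Sum>u\<in>avoiding_words (Suc n) \<union> (\<Union>j. first_words j (Suc n)). word_prob p u)"
    unfolding extensions_of_avoiding_words[symmetric] sum.reindex[OF inj]
    by (simp add: case_prod_unfold)
  also have "\<dots> = avoid_weight (Suc n) + (\<Sum>u\<in>(\<Union>j. first_words j (Suc n)). word_prob p u)"
    unfolding avoid_weight_def
  proof (rule sum.union_disjoint)
    show "avoiding_words (Suc n) \<inter> (\<Union>j. first_words j (Suc n)) = {}"
      by (auto simp: avoiding_words_def first_words_def dest: suffix_imp_sublist)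
  qed (auto simp: finite_avoiding_words finite_first_words)
  also have "(\<Sum>u\<in>(\<Union>j. first_words j (Suc n)). word_prob p u)
      = (\<Sum>j\<in>UNIV. first_weight j (Suc n))"
    unfolding first_weight_def
    using first_words_disjoint by (intro sum.UNION_disjoint) (simp_all add: finite_first_words)
  finally show ?thesis .
qed

lemma avoid_weight_le_1: "avoid_weight n \<le> 1"
proof (induction n)
  case (Suc n)
  have "0 \<le> (\<Sum>j\<in>UNIV. first_weight j (Suc n))"
    by (simp add: sum_nonneg first_weight_nonneg)
  then show ?case using Suc avoid_weight_Suc[of n] by linarith
qed (simp add: avoid_weight_0)

lemma first_weight_le_1: "first_weight j n \<le> 1"
proof (cases n)
  case 0
  then show ?thesis by (simp add: first_weight_short pattern_nonempty)
next
  case (Suc k)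
  have "first_weight j (Suc k) \<le> (\<Sum>j\<in>UNIV. first_weight j (Suc k))"
    by (rule member_le_sum) (auto simp: first_weight_nonneg)
  then have "first_weight j (Suc k) \<le> 1"
    using avoid_weight_Suc[of k] avoid_weight_le_1[of k] avoid_weight_nonneg[of "Suc k"] by linarith
  with Suc show ?thesis by simp
qed

text \<open>Once \<open>A i\<close> has been appended to an avoiding word, some pattern has occurred, so there is a
  shortest extension \<open>w @ take r (A i)\<close> that contains a pattern \<open>A j\<close>. The bound \<open>r \<le> length (A j)\<close>,
  which makes the occurrence reach back into \<open>w\<close> or start exactly where \<open>A i\<close> does, comes from
  reducedness: otherwise \<open>A j\<close> would be a proper block of \<open>A i\<close>.\<close>

lemma first_occurrence_in_extension:
  assumes w: "w \<in> avoiding_words n"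
  shows "\<exists>j. \<exists>r\<in>{1..min (length (A i)) (length (A j))}. \<forall>k. \<forall>t\<in>{1..length (A i)}.
    w @ take t (A i) \<in> first_words k (n + t) \<longleftrightarrow> k = j \<and> t = r"
proof -
  let ?hit = "\<lambda>t. \<exists>k. sublist (A k) (w @ take t (A i))"
  have wprops: "w \<in> lists \<Omega>" "length w = n" "\<not> sublist (A k) w" for k
    using w by (auto simp: avoiding_words_def)
  define r where "r = (LEAST t. ?hit t)"
  have "?hit (length (A i))" by (intro exI[of _ i]) simp
  then have r_hit: "?hit r" and r_le: "r \<le> length (A i)"
    unfolding r_def by (rule LeastI, rule Least_le)
  have before: "\<not> sublist (A k) (w @ take t (A i))" if "t < r" for k t
    using not_less_Least[of t ?hit] that by (auto simp: r_def)
  have r_pos: "r \<ge> 1"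
    using r_hit wprops(3) by (cases r) auto
  have butlast_ext: "butlast (w @ take t (A i)) = w @ take (t - 1) (A i)"
    if "1 \<le> t" "t \<le> length (A i)" for t
    using that by (auto simp: butlast_append butlast_take pattern_nonempty)
  obtain j where j: "sublist (A j) (w @ take r (A i))" using r_hit by blast
  have j_suffix: "suffix (A j) (w @ take r (A i))"
  proof -
    have ne: "w @ take r (A i) \<noteq> []" using r_pos pattern_nonempty[of i] by auto
    have "\<not> sublist (A j) (butlast (w @ take r (A i)))"
      using before[of "r - 1" j] butlast_ext[OF r_pos r_le] r_pos by simp
    then show ?thesis
      using j ne sublist_snoc[of "A j" "butlast (w @ take r (A i))" "last (w @ take r (A i))"]
      by simp
  qed
  have r_le': "r \<le> length (A j)"
  proof (rule ccontr)
    assume *: "\<not> r \<le> length (A j)"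
    have "suffix (A j) (take r (A i))"
      using j_suffix * r_le by (auto simp: suffix_append dest!: suffix_length_le)
    then have "sublist (A j) (A i)"
      using suffix_imp_sublist sublist_order.order_trans sublist_take by blast
    then have "j = i" by (rule sublist_patterns_eq)
    with * r_le show False by simp
  qed
  have uniq: "w @ take t (A i) \<in> first_words k (n + t) \<longleftrightarrow> k = j \<and> t = r"
    if t: "1 \<le> t" "t \<le> length (A i)" for k t
  proof
    assume asm: "w @ take t (A i) \<in> first_words k (n + t)"
    then have suf: "suffix (A k) (w @ take t (A i))"
      and av: "\<not> sublist (A j) (w @ take (t - 1) (A i))"
      by (auto simp: first_words_def butlast_ext[OF t])
    have "\<not> t < r" using before[of t k] suf by auto
    moreover have "\<not> r < t"
    proof
      assume "r < t"
      then have "take (t - 1) (A i) = take r (A i) @ take (t - 1 - r) (drop r (A i))"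
        using take_add[of r "t - 1 - r" "A i"] by simp
      then have "sublist (w @ take r (A i)) (w @ take (t - 1) (A i))"
        using sublist_append_rightI[of "w @ take r (A i)" "take (t - 1 - r) (drop r (A i))"]
        by (metis append_assoc)
      with j av show False using sublist_order.order_trans by blast
    qed
    ultimately have "t = r" by simp
    with suf j_suffix suffix_patterns_eq show "k = j \<and> t = r" by blast
  next
    assume "k = j \<and> t = r"
    moreover have "set (take r (A i)) \<subseteq> \<Omega>"
      using pattern_letters[of i] by (auto dest: in_set_takeD)
    ultimately show "w @ take t (A i) \<in> first_words k (n + t)"
      using wprops r_le r_pos before[of "r - 1"] j_suffix
      by (auto simp: first_words_def butlast_ext[OF r_pos r_le])
  qed
  show ?thesis
    using uniq r_pos r_le r_le' by (intro exI[of _ j] bexI[of _ r]) auto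
qed

text \<open>A word of length \<open>n + r\<close> in which \<open>A j\<close> occurs for the first time at its end is determined by
  its first \<open>n\<close> letters once its last \<open>r\<close> letters are prescribed. If \<open>A i\<close> and \<open>A j\<close> overlap in
  \<open>r\<close> letters, the prescribed letters are automatic; if they do not, no avoiding word can be
  extended to such a word by these letters, and both sides vanish.\<close>

lemma first_weight_extension:
  assumes r: "r \<in> {1..min (length (A i)) (length (A j))}"
  shows "of_bool (first_letters r (A i) = last_letters r (A j)) * first_weight j (n + r)
    = (\<Sum>w\<in>avoiding_words n. of_bool (w @ take r (A i) \<in> first_words j (n + r)) *
         (word_prob p w * word_prob p (take r (A i))))"
proof -
  let ?W = "{w \<in> avoiding_words n. w @ take r (A i) \<in> first_words j (n + r)}"
  let ?e = "\<lambda>w. w @ take r (A i)"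
  have overlap: "last_letters r (A j) = drop n u"
    if "u \<in> first_words j (n + r)" for u
  proof -
    from that obtain zs where u: "u = zs @ A j" "length zs + length (A j) = n + r"
      by (auto simp: first_words_def suffix_def)
    then have "length (A j) - r = n - length zs" "n \<ge> length zs" using r by auto
    then show ?thesis using u by (simp add: last_letters_def)
  qed
  have "of_bool (first_letters r (A i) = last_letters r (A j)) * first_weight j (n + r)
    = (\<Sum>w\<in>?W. word_prob p (?e w))"
  proof (cases "first_letters r (A i) = last_letters r (A j)")
    case True
    have img: "first_words j (n + r) = ?e ` ?W"
    proof (intro equalityI subsetI)
      fix u assume u: "u \<in> first_words j (n + r)"
      then have "u = ?e (take n u)"
        using overlap[OF u] True by (simp add: first_letters_def)
      moreover have "take n u \<in> avoiding_words n"
      proof -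
        have "take n u = take n (butlast u)"
          using u r by (auto simp: first_words_def take_butlast)
        then have "sublist (take n u) (butlast u)" by simp
        then show ?thesis
          using u by (auto simp: first_words_def avoiding_words_def
              dest: in_set_takeD sublist_order.order_trans)
      qed
      ultimately show "u \<in> ?e ` ?W" using u by (metis (mono_tags, lifting) image_eqI mem_Collect_eq)
    qed auto
    have inj: "inj_on ?e ?W" by (auto simp: inj_on_def)
    have "first_weight j (n + r) = sum (word_prob p) (?e ` ?W)"
      unfolding first_weight_def using img by (rule arg_cong)
    also have "\<dots> = (\<Sum>w\<in>?W. word_prob p (?e w))"
      by (simp add: sum.reindex[OF inj])
    finally show ?thesis using True by simp
  next
    case False
    have "?W = {}"
    proof (rule ccontr)
      assume "?W \<noteq> {}"
      then obtain w where w: "length w = n" "?e w \<in> first_words j (n + r)"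
        by (auto simp: avoiding_words_def)
      from overlap[OF w(2)] w(1) False show False by (simp add: first_letters_def)
    qed
    then show ?thesis unfolding \<open>?W = {}\<close> using False by simp
  qed
  also have "\<dots> = (\<Sum>w\<in>avoiding_words n. if ?e w \<in> first_words j (n + r)
      then word_prob p (?e w) else 0)"
    by (simp add: sum.If_cases finite_avoiding_words Int_def)
  also have "\<dots> = (\<Sum>w\<in>avoiding_words n. of_bool (?e w \<in> first_words j (n + r)) *
         (word_prob p w * word_prob p (take r (A i))))"
    by (intro sum.cong) (auto simp: word_prob_append)
  finally show ?thesis .
qed

text \<open>The words \<open>w @ A i\<close> with \<open>w\<close> avoiding, classified by the first pattern occurrence in them.\<close>

lemma avoid_weight_times_pattern:
  "avoid_weight n * word_prob p (A i) =
    (\<Sum>j\<in>UNIV. \<Sum>r = 1..min (length (A i)) (length (A j)).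
       of_bool (first_letters r (A i) = last_letters r (A j)) *
       word_prob p (last_letters (length (A i) - r) (A i)) * first_weight j (n + r))"
  (is "_ = (\<Sum>j\<in>UNIV. \<Sum>r\<in>?R j. ?c j r)")
proof -
  let ?e = "\<lambda>w r. w @ take r (A i)"
  let ?F = "\<lambda>w j r. of_bool (?e w r \<in> first_words j (n + r)) :: real"
  have c: "?c j r = (\<Sum>w\<in>avoiding_words n. word_prob p w * word_prob p (A i) * ?F w j r)"
    if r: "r \<in> ?R j" for j r
  proof -
    (* The first r letters of A i complete A j, the others contribute the remaining factor. *)
    have split: "word_prob p (take r (A i)) * word_prob p (last_letters (length (A i) - r) (A i))
        = word_prob p (A i)"
      using r by (simp add: last_letters_def flip: word_prob_append)
    have "?c j r = word_prob p (last_letters (length (A i) - r) (A i)) *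
      (of_bool (first_letters r (A i) = last_letters r (A j)) * first_weight j (n + r))"
      by (simp add: mult_ac)
    also have "\<dots> = (\<Sum>w\<in>avoiding_words n. ?F w j r * word_prob p w *
        (word_prob p (take r (A i)) * word_prob p (last_letters (length (A i) - r) (A i))))"
      unfolding first_weight_extension[OF r] sum_distrib_left by (simp add: mult_ac)
    finally show ?thesis unfolding split by (simp add: mult_ac)
  qed
  have one: "(\<Sum>j\<in>UNIV. \<Sum>r\<in>?R j. ?F w j r) = 1" if w: "w \<in> avoiding_words n" for w
  proof -
    obtain j0 r0 where r0: "r0 \<in> ?R j0"
      and *: "\<forall>k. \<forall>t\<in>{1..length (A i)}.
                ?e w t \<in> first_words k (n + t) \<longleftrightarrow> k = j0 \<and> t = r0"
      using first_occurrence_in_extension[OF w, of i] by blast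
    (* Exactly one pair (j, r) marks the first occurrence in w followed by A i. *)
    have "(\<Sum>j\<in>UNIV. \<Sum>r\<in>?R j. ?F w j r) =
        (\<Sum>j\<in>UNIV. \<Sum>r\<in>?R j. if r = r0 then of_bool (j = j0) else 0)"
      using * by (intro sum.cong refl) auto
    also have "\<dots> = (\<Sum>j\<in>UNIV. if j = j0 then of_bool (r0 \<in> ?R j) else 0)"
      by (intro sum.cong refl) auto
    also have "\<dots> = 1" using r0 by simp
    finally show ?thesis .
  qed
  have "(\<Sum>j\<in>UNIV. \<Sum>r\<in>?R j. ?c j r)
      = (\<Sum>j\<in>UNIV. \<Sum>r\<in>?R j. \<Sum>w\<in>avoiding_words n. word_prob p w * word_prob p (A i) * ?F w j r)"
    by (intro sum.cong refl c)
  also have "\<dots> = (\<Sum>j\<in>UNIV. \<Sum>w\<in>avoiding_words n. \<Sum>r\<in>?R j. word_prob p w * word_prob p (A i) * ?F w j r)"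
    by (intro sum.cong refl sum.swap)
  also have "\<dots> = (\<Sum>w\<in>avoiding_words n. \<Sum>j\<in>UNIV. \<Sum>r\<in>?R j. word_prob p w * word_prob p (A i) * ?F w j r)"
    by (rule sum.swap)
  also have "\<dots> = (\<Sum>w\<in>avoiding_words n. word_prob p w * word_prob p (A i) * (\<Sum>j\<in>UNIV. \<Sum>r\<in>?R j. ?F w j r))"
    by (simp only: sum_distrib_left)
  also have "\<dots> = (\<Sum>w\<in>avoiding_words n. word_prob p w * word_prob p (A i))"
    by (intro sum.cong refl) (simp only: one mult_1_right)
  also have "\<dots> = avoid_weight n * word_prob p (A i)"
    by (simp add: avoid_weight_def sum_distrib_right)
  finally show ?thesis ..
qed

section \<open>Generating functions and Cramer's rule\<close>

definition avoid_gf :: "real \<Rightarrow> real" where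
  "avoid_gf s = (\<Sum>n. avoid_weight n * s ^ n)"

definition hit_gf :: "'m \<Rightarrow> real \<Rightarrow> real" where
  "hit_gf j s = (\<Sum>n. first_weight j n * s ^ n)"

context
  fixes s :: real
  assumes s: "0 \<le> s" "s < 1"
begin

lemma avoid_gf_sums: "(\<lambda>n. avoid_weight n * s ^ n) sums avoid_gf s"
  unfolding avoid_gf_def
proof (rule summable_sums, rule summable_comparison_test'[where g = "\<lambda>n. s ^ n" and N = 0])
  show "summable (\<lambda>n. s ^ n)" using s by simp
  show "norm (avoid_weight n * s ^ n) \<le> s ^ n" for n
    using s avoid_weight_nonneg[of n] avoid_weight_le_1[of n] by (simp add: mult_left_le_one_le)
qed

lemma hit_gf_sums: "(\<lambda>n. first_weight j n * s ^ n) sums hit_gf j s"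
  unfolding hit_gf_def
proof (rule summable_sums, rule summable_comparison_test'[where g = "\<lambda>n. s ^ n" and N = 0])
  show "summable (\<lambda>n. s ^ n)" using s by simp
  show "norm (first_weight j n * s ^ n) \<le> s ^ n" for n
    using s first_weight_nonneg[of j n] first_weight_le_1[of j n] by (simp add: mult_left_le_one_le)
qed

lemma avoid_gf_ge_1: "avoid_gf s \<ge> 1"
proof -
  have "(\<Sum>n<1. avoid_weight n * s ^ n) \<le> avoid_gf s"
    unfolding avoid_gf_def using s avoid_gf_sums
    by (intro sum_le_suminf) (auto simp: avoid_weight_nonneg sums_iff)
  then show ?thesis by (simp add: avoid_weight_0)
qed

lemma gf_total: "(1 - s) * avoid_gf s + (\<Sum>j\<in>UNIV. hit_gf j s) = 1"
proof -
  have "(\<lambda>n. avoid_weight (n + 1) * s ^ (n + 1)) sums (avoid_gf s - 1)"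
    using avoid_gf_sums sums_iff_shift[of "\<lambda>n. avoid_weight n * s ^ n" 1 "avoid_gf s - 1"]
    by (simp add: avoid_weight_0)
  moreover have "(\<lambda>n. first_weight j (n + 1) * s ^ (n + 1)) sums hit_gf j s" for j
    using hit_gf_sums sums_zero_iff_shift[of 1 "\<lambda>n. first_weight j n * s ^ n" "hit_gf j s"]
    by (simp add: first_weight_short pattern_nonempty)
  ultimately have "(\<lambda>n. avoid_weight (n + 1) * s ^ (n + 1)
      + (\<Sum>j\<in>UNIV. first_weight j (n + 1) * s ^ (n + 1)))
      sums (avoid_gf s - 1 + (\<Sum>j\<in>UNIV. hit_gf j s))"
    by (intro sums_add sums_sum)
  moreover have "avoid_weight (n + 1) * s ^ (n + 1)
      + (\<Sum>j\<in>UNIV. first_weight j (n + 1) * s ^ (n + 1)) = s * (avoid_weight n * s ^ n)" for n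
    using avoid_weight_Suc[of n] by (simp add: algebra_simps flip: sum_distrib_left)
  ultimately have "(\<lambda>n. s * (avoid_weight n * s ^ n))
      sums (avoid_gf s - 1 + (\<Sum>j\<in>UNIV. hit_gf j s))" by simp
  from sums_unique2[OF this sums_mult[OF avoid_gf_sums]] show ?thesis
    by (simp add: algebra_simps)
qed

text \<open>Multiplying \<open>avoid_weight_times_pattern\<close> by \<open>s ^ (n + length (A i))\<close> and summing over \<open>n\<close> makes
  each inner series the whole of \<open>hit_gf j s\<close>: only the terms of index below
  \<open>r \<le> length (A j)\<close> are missing, and these are zero.\<close>

lemma correlation_system:
  "(\<Sum>j\<in>UNIV. correlation p (A i) (A j) s * hit_gf j s)
     = word_prob p (A i) * s ^ length (A i) * avoid_gf s"
proof -
  let ?R = "\<lambda>j. {1..min (length (A i)) (length (A j))}"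
  let ?c = "\<lambda>j r. of_bool (first_letters r (A i) = last_letters r (A j)) *
       word_prob p (last_letters (length (A i) - r) (A i))"
  have shift: "(\<lambda>n. first_weight j (n + r) * s ^ (n + r)) sums hit_gf j s" if "r \<in> ?R j" for j r
    using hit_gf_sums sums_zero_iff_shift[of r "\<lambda>n. first_weight j n * s ^ n" "hit_gf j s"] that
    by (simp add: first_weight_short)
  have "(\<lambda>n. \<Sum>j\<in>UNIV. \<Sum>r\<in>?R j. ?c j r * s ^ (length (A i) - r) *
        (first_weight j (n + r) * s ^ (n + r)))
      sums (\<Sum>j\<in>UNIV. \<Sum>r\<in>?R j. ?c j r * s ^ (length (A i) - r) * hit_gf j s)"
    by (intro sums_sum sums_mult shift)
  moreover have "(\<Sum>j\<in>UNIV. \<Sum>r\<in>?R j. ?c j r * s ^ (length (A i) - r) *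
        (first_weight j (n + r) * s ^ (n + r)))
      = word_prob p (A i) * s ^ length (A i) * (avoid_weight n * s ^ n)" for n
  proof -
    have "?c j r * s ^ (length (A i) - r) * (first_weight j (n + r) * s ^ (n + r))
        = s ^ n * s ^ length (A i) * (?c j r * first_weight j (n + r))" if "r \<in> ?R j" for j r
    proof -
      have "s ^ (length (A i) - r) * s ^ (n + r) = s ^ n * s ^ length (A i)"
        using that by (simp add: add.commute flip: power_add)
      moreover have "?c j r * s ^ (length (A i) - r) * (first_weight j (n + r) * s ^ (n + r))
        = s ^ (length (A i) - r) * s ^ (n + r) * (?c j r * first_weight j (n + r))"
        by (simp only: mult_ac)
      ultimately show ?thesis by simp
    qed
    note summand = this
    have "(\<Sum>j\<in>UNIV. \<Sum>r\<in>?R j. ?c j r * s ^ (length (A i) - r) *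
        (first_weight j (n + r) * s ^ (n + r)))
      = (\<Sum>j\<in>UNIV. \<Sum>r\<in>?R j. s ^ n * s ^ length (A i) * (?c j r * first_weight j (n + r)))"
      by (intro sum.cong refl summand)
    also have "\<dots> = s ^ n * s ^ length (A i) * (avoid_weight n * word_prob p (A i))"
      unfolding avoid_weight_times_pattern sum_distrib_left by simp
    finally show ?thesis by (simp add: mult_ac)
  qed
  ultimately have "(\<lambda>n. word_prob p (A i) * s ^ length (A i) * (avoid_weight n * s ^ n))
      sums (\<Sum>j\<in>UNIV. \<Sum>r\<in>?R j. ?c j r * s ^ (length (A i) - r) * hit_gf j s)"
    by simp
  from sums_unique2[OF this sums_mult[OF avoid_gf_sums]] show ?thesis
    by (simp add: correlation_def sum_distrib_right)
qed

text \<open>Cramer's rule for the system divided by \<open>avoid_gf s\<close>, so that its right-hand side is the column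
  that is substituted into the matrix. The division is harmless because \<open>avoid_gf\<close> has the
  constant term \<open>1\<close> and nonnegative coefficients.\<close>

lemma det_corr_matrix_repl:
  "det (corr_matrix_repl p A j s) = hit_gf j s / avoid_gf s * det (corr_matrix p A s)"
proof -
  let ?x = "\<chi> j. hit_gf j s / avoid_gf s"
  have "(corr_matrix p A s *v ?x) $ i = word_prob p (A i) * s ^ length (A i)" for i
    using correlation_system[of i] avoid_gf_ge_1
    by (simp add: matrix_vector_mult_def corr_matrix_def field_simps flip: sum_divide_distrib)
  then have "corr_matrix_repl p A j s
      = (\<chi> i k. if k = j then (corr_matrix p A s *v ?x) $ i else corr_matrix p A s $ i $ k)"
    by (auto simp: corr_matrix_repl_def vec_eq_iff)
  then show ?thesis
    by (simp add: cramer_lemma)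
qed

lemma precede_denom_avoid_gf: "avoid_gf s * precede_denom p A s = det (corr_matrix p A s)"
proof -
  let ?D = "det (corr_matrix p A s)"
  have "(\<Sum>j\<in>UNIV. det (corr_matrix_repl p A j s)) = (\<Sum>j\<in>UNIV. hit_gf j s) / avoid_gf s * ?D"
    by (simp add: det_corr_matrix_repl sum_divide_distrib sum_distrib_right)
  then have "avoid_gf s * precede_denom p A s
      = avoid_gf s * ((\<Sum>j\<in>UNIV. hit_gf j s) / avoid_gf s * ?D) + avoid_gf s * ((1 - s) * ?D)"
    by (simp add: precede_denom_def distrib_left)
  also have "\<dots> = ((1 - s) * avoid_gf s + (\<Sum>j\<in>UNIV. hit_gf j s)) * ?D"
    using avoid_gf_ge_1 by (simp add: algebra_simps)
  finally show ?thesis by (simp add: gf_total)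
qed

lemma hit_gf_eq_det_quotient:
  assumes "det (corr_matrix p A s) \<noteq> 0"
  shows "precede_denom p A s \<noteq> 0"
    and "det (corr_matrix_repl p A j s) / precede_denom p A s = hit_gf j s"
proof -
  show nz: "precede_denom p A s \<noteq> 0"
    using assms precede_denom_avoid_gf by auto
  show "det (corr_matrix_repl p A j s) / precede_denom p A s = hit_gf j s"
    using nz avoid_gf_ge_1
    by (simp add: det_corr_matrix_repl flip: precede_denom_avoid_gf)
qed

end

text \<open>At \<open>s = 0\<close> the correlation keeps only the overlap in all letters of the first pattern, which
  makes that pattern a suffix of the second one; in a reduced family this happens on the diagonal
  only.\<close>

lemma corr_matrix_0: "corr_matrix p A 0 = mat 1"
proof -
  have "correlation p (A i) (A j) 0 = of_bool (i = j)" for i j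
  proof -
    let ?R = "{1..min (length (A i)) (length (A j))}"
    have "correlation p (A i) (A j) 0
        = (\<Sum>k\<in>?R. if k = length (A i) then of_bool (A i = last_letters k (A j)) else 0)"
      unfolding correlation_def
      by (intro sum.cong refl) (auto simp: first_letters_def last_letters_def)
    also have "\<dots> = of_bool (length (A i) \<in> ?R \<and> A i = last_letters (length (A i)) (A j))"
      by (auto simp: sum.delta)
    also have "length (A i) \<in> ?R \<and> A i = last_letters (length (A i)) (A j) \<longleftrightarrow> i = j"
    proof
      assume "length (A i) \<in> ?R \<and> A i = last_letters (length (A i)) (A j)"
      then have "sublist (A i) (A j)" by (metis last_letters_def sublist_drop)
      then show "i = j" by (rule sublist_patterns_eq)
    next
      assume "i = j"
      then show "length (A i) \<in> ?R \<and> A i = last_letters (length (A i)) (A j)"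
        by (simp add: last_letters_def Suc_le_eq pattern_nonempty)
    qed
    finally show ?thesis .
  qed
  then show ?thesis
    by (simp add: corr_matrix_def mat_def vec_eq_iff)
qed

lemma det_corr_matrix_nonzero_near_1: "\<forall>\<^sub>F s in at_left 1. det (corr_matrix p A s) \<noteq> 0"
proof -
  have "real_polynomial_function (\<lambda>s. correlation p (A i) (A j) s)" for i j
    unfolding correlation_def
    by (intro real_polynomial_function_sum real_polynomial_function.intros real_polynomial_function_power) auto
  then have "real_polynomial_function (\<lambda>s. det (corr_matrix p A s))"
    unfolding det_def corr_matrix_def vec_lambda_beta
    by (intro real_polynomial_function_sum real_polynomial_function.intros(2,4) real_polynomial_function_prod) auto
  then obtain a n where poly: "(\<lambda>s. det (corr_matrix p A s)) = (\<lambda>s. \<Sum>k\<le>n. a k * s ^ k)"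
    using real_polynomial_function_iff_sum by metis
  have "(\<Sum>k\<le>n. a k * 0 ^ k) = 1"
    using fun_cong[OF poly, of 0] by (simp add: corr_matrix_0)
  then have "\<exists>k\<le>n. a k \<noteq> 0"
    by (intro ccontr[of "\<exists>k\<le>n. a k \<noteq> 0"]) simp
  then have "finite {s. det (corr_matrix p A s) = 0}"
    unfolding fun_cong[OF poly] by (simp add: polyfun_finite_roots)
  then have "\<not> (1::real) islimpt {s. det (corr_matrix p A s) = 0}"
    by (rule islimpt_finite)
  then have "\<forall>\<^sub>F s in at 1. det (corr_matrix p A s) \<noteq> 0"
    by (simp add: islimpt_iff_eventually)
  then show ?thesis
    by (rule filter_leD[OF at_le, rotated]) simp
qed

text \<open>Abel's limit theorem, which for nonnegative coefficients follows from uniform convergence on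
  the closed interval.\<close>

lemma hit_gf_tendsto_left:
  assumes "summable (first_weight j)"
  shows "(hit_gf j \<longlongrightarrow> hit_gf j 1) (at_left 1)"
proof -
  have "uniform_limit {0..1} (\<lambda>n s. \<Sum>k<n. first_weight j k * s ^ k) (hit_gf j) sequentially"
    unfolding hit_gf_def
  proof (rule Weierstrass_m_test[OF _ assms])
    show "norm (first_weight j n * s ^ n) \<le> first_weight j n" if "s \<in> {0..1}" for n and s :: real
      using that by (simp add: first_weight_nonneg mult_left_le power_le_one)
  qed
  then have "continuous_on {0..1} (hit_gf j)"
    by (rule uniform_limit_theorem[rotated])
       (auto intro!: always_eventually continuous_intros)
  then have "(hit_gf j \<longlongrightarrow> hit_gf j 1) (at 1 within {0..1})"
    by (simp add: continuous_on)
  then show ?thesis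
    by (simp add: at_within_Icc_at_left)
qed

lemma det_quotient_tendsto:
  assumes "summable (first_weight i)"
  shows "\<forall>\<^sub>F s in at_left 1. precede_denom p A s \<noteq> 0"
    and "((\<lambda>s. det (corr_matrix_repl p A i s) / precede_denom p A s)
            \<longlongrightarrow> (\<Sum>n. first_weight i n)) (at_left 1)"
proof -
  have unit: "\<forall>\<^sub>F s in at_left (1::real). 0 \<le> s \<and> s < 1"
    using eventually_at_left_real[OF zero_less_one] by (rule eventually_mono) auto
  show "\<forall>\<^sub>F s in at_left 1. precede_denom p A s \<noteq> 0"
    using unit det_corr_matrix_nonzero_near_1
    by eventually_elim (simp add: hit_gf_eq_det_quotient)
  have "\<forall>\<^sub>F s in at_left 1. hit_gf i s = det (corr_matrix_repl p A i s) / precede_denom p A s"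
    using unit det_corr_matrix_nonzero_near_1
    by eventually_elim (simp add: hit_gf_eq_det_quotient)
  with hit_gf_tendsto_left[OF assms]
  show "((\<lambda>s. det (corr_matrix_repl p A i s) / precede_denom p A s)
            \<longlongrightarrow> (\<Sum>n. first_weight i n)) (at_left 1)"
    by (simp add: hit_gf_def tendsto_cong)
qed

end

section \<open>Occurrence times in terms of initial words\<close>

definition first_word :: "(nat \<Rightarrow> 'a) \<Rightarrow> nat \<Rightarrow> 'a list" where
  "first_word x n = map x [1..<n + 1]"

lemma length_first_word [simp]: "length (first_word x n) = n"
  by (simp add: first_word_def)

lemma take_first_word: "m \<le> n \<Longrightarrow> take m (first_word x n) = first_word x m"
  by (simp add: first_word_def take_map take_upt del: upt_Suc)

lemma occurs_at_iff_suffix: "occurs_at x U n \<longleftrightarrow> suffix U (first_word x n)"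
proof -
  have "suffix U V \<longleftrightarrow> length U \<le> length V \<and> drop (length V - length U) V = U" for V
    by (auto simp: suffix_def) (metis append_take_drop_id)
  then show ?thesis
    by (simp add: occurs_at_def first_word_def drop_map del: upt_Suc)
qed

lemma sublist_first_word_iff: "sublist U (first_word x n) \<longleftrightarrow> (\<exists>m\<le>n. occurs_at x U m)"
proof -
  have "prefix V (first_word x n) \<longleftrightarrow> (\<exists>m\<le>n. V = first_word x m)" for V
  proof
    assume "prefix V (first_word x n)"
    then have "V = take (length V) (first_word x n)" "length V \<le> n"
      by (auto simp: prefix_def dest: arg_cong[of _ _ length])
    then show "\<exists>m\<le>n. V = first_word x m"
      using take_first_word by metis
  next
    assume "\<exists>m\<le>n. V = first_word x m"
    then show "prefix V (first_word x n)"
      by (metis take_first_word take_is_prefix)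
  qed
  then show ?thesis
    by (auto simp: sublist_altdef occurs_at_iff_suffix)
qed

lemma enat_le_hit_time_iff: "enat n \<le> hit_time x U \<longleftrightarrow> (\<forall>m<n. \<not> occurs_at x U m)"
proof -
  have "enat n \<le> hit_time x U \<longleftrightarrow> (\<forall>m. occurs_at x U m \<longrightarrow> n \<le> m)"
    by (auto simp: hit_time_def le_Inf_iff)
  then show ?thesis by (meson not_le)
qed

lemma hit_time_eq_enatD:
  assumes "hit_time x U = enat n"
  shows "occurs_at x U n"
proof -
  have "enat n \<le> hit_time x U" "\<not> enat (Suc n) \<le> hit_time x U"
    using assms by auto
  then obtain m where "m < Suc n" "occurs_at x U m" "\<not> m < n"
    unfolding enat_le_hit_time_iff by blast
  then show ?thesis by (simp add: less_Suc_eq)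
qed

text \<open>The stopping times enter the combinatorics here: the conditions on the two times become
  membership of the initial word of length \<open>n\<close> in \<open>first_words\<close>. For \<open>n = 0\<close> both sides fail, as
  patterns are nonempty.\<close>

lemma first_at_iff:
  fixes A :: "'m::finite \<Rightarrow> 'a list"
  assumes "\<And>j. A j \<noteq> []"
  shows "min_hit_time x A = hit_time x (A i) \<and> hit_time x (A i) = enat n \<longleftrightarrow>
    suffix (A i) (first_word x n) \<and> (\<forall>k. \<not> sublist (A k) (butlast (first_word x n)))"
proof -
  have min_iff: "min_hit_time x A = hit_time x (A i) \<longleftrightarrow> (\<forall>k. hit_time x (A i) \<le> hit_time x (A k))"
    unfolding min_hit_time_def
    by (auto simp: Min_eq_iff)
  have hit: "hit_time x (A i) = enat n \<longleftrightarrow> occurs_at x (A i) n \<and> enat n \<le> hit_time x (A i)"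
  proof
    assume "occurs_at x (A i) n \<and> enat n \<le> hit_time x (A i)"
    moreover from this have "hit_time x (A i) \<le> enat n"
      unfolding hit_time_def by (intro Inf_lower) auto
    ultimately show "hit_time x (A i) = enat n" by simp
  qed (simp add: hit_time_eq_enatD)
  have "butlast (first_word x n) = first_word x (n - 1)"
    by (simp add: butlast_conv_take take_first_word)
  then have "sublist (A k) (butlast (first_word x n)) \<longleftrightarrow> (\<exists>m\<le>n - 1. occurs_at x (A k) m)" for k
    by (simp add: sublist_first_word_iff)
  moreover have "(\<exists>m\<le>n - 1. occurs_at x (A k) m) \<longleftrightarrow> (\<exists>m<n. occurs_at x (A k) m)" for k
    using assms[of k] by (cases n) (auto simp: less_Suc_eq_le occurs_at_def)
  ultimately have "(\<forall>k. \<not> sublist (A k) (butlast (first_word x n)))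
      \<longleftrightarrow> (\<forall>k. enat n \<le> hit_time x (A k))"
    by (auto simp: enat_le_hit_time_iff)
  then show ?thesis
    using hit min_iff by (auto simp: occurs_at_iff_suffix)
qed

section \<open>The law of the initial words\<close>

locale iid_letters = prob_space M
  for M :: "'w measure" +
  fixes \<Omega> :: "'a set" and \<xi> :: "nat \<Rightarrow> 'w \<Rightarrow> 'a"
  assumes finite_letters: "finite \<Omega>"
    and indep: "indep_vars (\<lambda>_. count_space \<Omega>) \<xi> {1..}"
    and ident: "\<And>n. n \<ge> 1 \<Longrightarrow> distr M (count_space \<Omega>) (\<xi> n) = distr M (count_space \<Omega>) (\<xi> 1)"
begin

lemma letter_measurable: "n \<ge> 1 \<Longrightarrow> \<xi> n \<in> M \<rightarrow>\<^sub>M count_space \<Omega>"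
  using indep by (auto simp: indep_vars_def)

lemma letter_in_alphabet: "n \<ge> 1 \<Longrightarrow> \<omega> \<in> space M \<Longrightarrow> \<xi> n \<omega> \<in> \<Omega>"
  using measurable_space[OF letter_measurable] by auto

lemma prob_letter:
  assumes "n \<ge> 1" "a \<in> \<Omega>"
  shows "prob (\<xi> n -` {a} \<inter> space M) = letter_prob M \<xi> a"
proof -
  have "measure (distr M (count_space \<Omega>) (\<xi> n)) {a} = measure (distr M (count_space \<Omega>) (\<xi> 1)) {a}"
    using ident[OF assms(1)] by simp
  then have "prob (\<xi> n -` {a} \<inter> space M) = prob (\<xi> 1 -` {a} \<inter> space M)"
    using assms by (simp add: measure_distr letter_measurable)
  then show ?thesis
    by (simp add: letter_prob_def vimage_def Int_def conj_commute)
qed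

lemma sum_letter_prob: "(\<Sum>a\<in>\<Omega>. letter_prob M \<xi> a) = 1"
proof -
  have "(\<Sum>a\<in>\<Omega>. letter_prob M \<xi> a) = (\<Sum>a\<in>\<Omega>. prob (\<xi> 1 -` {a} \<inter> space M))"
    by (intro sum.cong refl) (simp add: prob_letter)
  also have "\<dots> = prob (\<Union>a\<in>\<Omega>. \<xi> 1 -` {a} \<inter> space M)"
    by (intro finite_measure_finite_Union[symmetric])
       (auto simp: finite_letters disjoint_family_on_def intro!: measurable_sets[OF letter_measurable])
  also have "(\<Union>a\<in>\<Omega>. \<xi> 1 -` {a} \<inter> space M) = space M"
    using letter_in_alphabet[of 1] by auto
  finally show ?thesis by (simp add: prob_space)
qed

lemma word_event:
  assumes "w \<in> lists \<Omega>"
  shows "{\<omega> \<in> space M. first_word (\<lambda>k. \<xi> k \<omega>) (length w) = w} \<in> events"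
    and "prob {\<omega> \<in> space M. first_word (\<lambda>k. \<xi> k \<omega>) (length w) = w} = word_prob (letter_prob M \<xi>) w"
proof -
  let ?n = "length w"
  let ?E = "{\<omega> \<in> space M. first_word (\<lambda>k. \<xi> k \<omega>) ?n = w}"
  have E: "?E = {\<omega> \<in> space M. \<forall>k\<in>{1..?n}. \<xi> k \<omega> = w ! (k - 1)}"
  proof -
    have "first_word x ?n = w \<longleftrightarrow> (\<forall>k\<in>{1..?n}. x k = w ! (k - 1))" for x :: "nat \<Rightarrow> 'a"
    proof -
      have "first_word x ?n = w \<longleftrightarrow> (\<forall>k<?n. x (Suc k) = w ! k)"
        unfolding list_eq_iff_nth_eq by (simp add: first_word_def del: upt_Suc)
      also have "\<dots> \<longleftrightarrow> (\<forall>k\<in>Suc ` {..<?n}. x k = w ! (k - 1))" by auto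
      finally show ?thesis by (simp only: image_Suc_lessThan)
    qed
    then show ?thesis by simp
  qed
  have letters: "w ! (k - 1) \<in> \<Omega>" if "k \<in> {1..?n}" for k
    using that assms by (auto simp: in_lists_conv_set)
  have ms: "\<xi> k -` {w ! (k - 1)} \<inter> space M \<in> events" if "k \<in> {1..?n}" for k
    using that letters by (intro measurable_sets[OF letter_measurable]) auto
  (* The intersection over an empty index set would be UNIV instead of the sample space. *)
  have E_inter: "?E = (\<Inter>k\<in>{1..?n}. \<xi> k -` {w ! (k - 1)} \<inter> space M)" if "w \<noteq> []"
    unfolding E using that by (auto simp: Suc_le_eq)
  show "?E \<in> events"
  proof (cases "w = []")
    case True
    then show ?thesis by (simp add: first_word_def)
  next
    case False
    then show ?thesis
      unfolding E_inter[OF False] by (intro sets.finite_INT ms) (auto simp: Suc_le_eq)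
  qed
  show "prob ?E = word_prob (letter_prob M \<xi>) w"
  proof (cases "w = []")
    case True
    then show ?thesis by (simp add: first_word_def prob_space)
  next
    case False
    note E_inter[OF False]
    moreover have "prob (\<Inter>k\<in>{1..?n}. \<xi> k -` {w ! (k - 1)} \<inter> space M)
        = (\<Prod>k\<in>{1..?n}. prob (\<xi> k -` {w ! (k - 1)} \<inter> space M))"
      using False letters
      by (intro indep_varsD[OF indep]) (auto simp: Suc_le_eq)
    moreover have "\<dots> = (\<Prod>k\<in>{1..?n}. letter_prob M \<xi> (w ! (k - 1)))"
      by (intro prod.cong refl prob_letter letters) auto
    moreover have "\<dots> = (\<Prod>k<?n. letter_prob M \<xi> (w ! k))"
      unfolding image_Suc_lessThan[symmetric] by (simp add: prod.reindex)
    ultimately show ?thesis by (simp add: word_prob_def)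
  qed
qed

lemma first_word_event:
  defines "S P n \<equiv> {w \<in> lists \<Omega>. length w = n \<and> P w}"
  shows "{\<omega> \<in> space M. P (first_word (\<lambda>k. \<xi> k \<omega>) n)} \<in> events"
    and "prob {\<omega> \<in> space M. P (first_word (\<lambda>k. \<xi> k \<omega>) n)}
           = (\<Sum>w\<in>S P n. word_prob (letter_prob M \<xi>) w)"
proof -
  let ?E = "\<lambda>w. {\<omega> \<in> space M. first_word (\<lambda>k. \<xi> k \<omega>) n = w}"
  have fin: "finite (S P n)"
    by (rule finite_subset[OF _ finite_lists_length_eq[OF finite_letters, of n]])
       (auto simp: S_def)
  have eq: "{\<omega> \<in> space M. P (first_word (\<lambda>k. \<xi> k \<omega>) n)} = (\<Union>w\<in>S P n. ?E w)"
    using letter_in_alphabet by (auto simp: S_def) (auto simp: first_word_def)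
  have ev: "?E w \<in> events" "prob (?E w) = word_prob (letter_prob M \<xi>) w" if "w \<in> S P n" for w
    using that word_event[of w] by (auto simp: S_def)
  show "{\<omega> \<in> space M. P (first_word (\<lambda>k. \<xi> k \<omega>) n)} \<in> events"
    unfolding eq using fin ev by (intro sets.finite_UN) auto
  have "prob (\<Union>w\<in>S P n. ?E w) = (\<Sum>w\<in>S P n. prob (?E w))"
    using fin ev by (intro finite_measure_finite_Union) (auto simp: disjoint_family_on_def)
  then show "prob {\<omega> \<in> space M. P (first_word (\<lambda>k. \<xi> k \<omega>) n)}
           = (\<Sum>w\<in>S P n. word_prob (letter_prob M \<xi>) w)"
    unfolding eq by (simp add: ev cong: sum.cong)
qed

text \<open>The event that \<open>A i\<close> comes first is the disjoint union over its finite occurrence times.\<close>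

lemma first_at_prob_sums_first_prob:
  fixes A :: "'m::finite \<Rightarrow> 'a list"
  assumes "\<And>j. A j \<noteq> []"
  shows "first_at_prob M \<xi> A i sums first_prob M \<xi> A i"
proof -
  let ?E = "\<lambda>n. {\<omega> \<in> space M. min_hit_time (\<lambda>k. \<xi> k \<omega>) A = hit_time (\<lambda>k. \<xi> k \<omega>) (A i) \<and>
               hit_time (\<lambda>k. \<xi> k \<omega>) (A i) = enat n}"
  have "?E n \<in> events" for n
    unfolding first_at_iff[where A = A, OF assms]
    by (rule first_word_event(1))
  then have "(\<lambda>n. prob (?E n)) sums prob (\<Union>n. ?E n)"
    by (intro finite_measure_UNION) (auto simp: disjoint_family_on_def)
  moreover have "(\<Union>n. ?E n) = {\<omega> \<in> space M. min_hit_time (\<lambda>k. \<xi> k \<omega>) A = hit_time (\<lambda>k. \<xi> k \<omega>) (A i) \<and>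
               hit_time (\<lambda>k. \<xi> k \<omega>) (A i) \<noteq> \<infinity>}"
    by auto
  moreover have "first_at_prob M \<xi> A i = (\<lambda>n. prob (?E n))"
    by (simp add: fun_eq_iff first_at_prob_def)
  ultimately show ?thesis
    by (simp only: first_prob_def)
qed

end

theorem corollary2p4:
  fixes M :: "'w measure" and \<Omega> :: "'a set" and \<xi> :: "nat \<Rightarrow> 'w \<Rightarrow> 'a"
    and A :: "'m::finite \<Rightarrow> 'a list" and i :: 'm
  assumes "prob_space M"
    and "finite \<Omega>"
    and "prob_space.indep_vars M (\<lambda>_. count_space \<Omega>) \<xi> {1..}"
    and "\<And>n. n \<ge> 1 \<Longrightarrow> distr M (count_space \<Omega>) (\<xi> n) = distr M (count_space \<Omega>) (\<xi> 1)"
    and "\<And>j. A j \<in> lists \<Omega>"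
    and "\<And>j. A j \<noteq> []"
    and "reduced_patterns A"
  shows "first_prob M \<xi> A i = first_gf M \<xi> A i 1
    \<and> (\<forall>\<^sub>F s in at_left 1. precede_denom (letter_prob M \<xi>) A s \<noteq> 0)
    \<and> ((\<lambda>s. det (corr_matrix_repl (letter_prob M \<xi>) A i s) / precede_denom (letter_prob M \<xi>) A s)
         \<longlongrightarrow> first_prob M \<xi> A i) (at_left 1)"
proof -
  interpret prob_space M by fact
  interpret iid_letters M \<Omega> \<xi>
    by unfold_locales (fact assms)+
  interpret reduced_pattern_family \<Omega> "letter_prob M \<xi>" A
  proof
    show "0 \<le> letter_prob M \<xi> a" for a
      by (simp add: letter_prob_def)
  qed (fact assms sum_letter_prob)+
  have "first_at_prob M \<xi> A i n = first_weight i n" for n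
    using first_word_event(2)[of "\<lambda>w. suffix (A i) w \<and> (\<forall>k. \<not> sublist (A k) (butlast w))" n]
    unfolding first_at_prob_def first_at_iff[where A = A, OF assms(6)] first_weight_def first_words_def
    by simp
  then have weights: "first_at_prob M \<xi> A i = first_weight i" by auto
  have sums: "first_weight i sums first_prob M \<xi> A i"
    using first_at_prob_sums_first_prob[where A = A and i = i, OF assms(6)] by (simp add: weights)
  then have "first_prob M \<xi> A i = (\<Sum>n. first_weight i n)" by (rule sums_unique)
  moreover have "first_gf M \<xi> A i 1 = (\<Sum>n. first_weight i n)"
    by (simp add: first_gf_def weights)
  ultimately show ?thesis
    using det_quotient_tendsto[OF sums_summable[OF sums]] by simp
qed

end
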